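(* Let $c>0$ be a constant. Suppose the graph sequence $H=H_n$ is strongly balanced with parameter $c$ and satisfies $v(H_n)\to\infty$, $|H_n|\to\infty$, and $$v(H_n)+|H_n|\ \le\ \frac{c\log n}{3\log\log n}.$$ Then the model of $H_n$ planted in $G(n,p)$ exhibits an all-or-nothing (AoN) transition at critical probability $p_{\mathrm{AoN}}=p_{1M}(H_n)$.
   Context: Graphs: $v(J)$ is the number of vertices of $J$; $|J|=e(J)$ is the number of edges. $K_n$ is the complete graph on $n$ vertices. Graphs in $K_n$ are identified with vectors in $\{0,1\}^{\binom n2}$ (edge indicators). Strongly balanced: $H$ is strongly balanced with parameter $c>0$ if $\frac{|J|}{v(J)-c}\le\frac{|H|}{v(H)-c}$ for all nonempty subgraphs $J\subseteq H$ (nonempty: having at least one edge), where the denominators are understood to be positive, i.e. $v(J)>c$ for all such $J$. Planted model: given $H=H_n$ with $v(H)\le n$, let $\mathcal S$ be the set of copies of $H$ in $K_n$ and $\mathbf P$ the uniform measure on $\mathcal S$. Under $\mathbb P_p$, one observes $\mathbf Y=\mathbf H\cup\mathbf G$, where $\mathbf H\sim\mathbf P$ and $\mathbf G\sim G(n,p)$ is independent of $\mathbf H$. Set $\mathrm{MMSE}_n(p)=\mathbb E_{\mathbb P_p}\big[\|\mathbf H-\mathbb E[\mathbf H\mid\mathbf Y]\|_2^2\big]\in[0,e(H)]$. AoN: the model exhibits an AoN transition at critical probability $p_{\mathrm{AoN}}=p_{\mathrm{AoN}}(n)\in[0,1]$ if for every constant $\epsilon>0$, $\lim_{n\to\infty}\mathrm{MMSE}_n(p)/e(H_n)=1$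 for all $p=p_n\in[0,1]$ with $p_n\ge(1+\epsilon)p_{\mathrm{AoN}}(n)$, and $\lim_{n\to\infty}\mathrm{MMSE}_n(p)/e(H_n)=0$ for all $p=p_n\in[0,1]$ with $p_n\le(1-\epsilon)p_{\mathrm{AoN}}(n)$. First moment threshold: $p_{1M}(H)=M_H^{-1/e(H)}$, where $M_H=\frac{n!/(n-v(H))!}{|\mathrm{Aut}(H)|}$ is the number of copies of $H$ in $K_n$. *)

theory Defs
  imports "HOL-Probability.Probability" "HOL-Probability.Product_PMF"
    "HOL-Probability.Conditional_Expectation" "HOL-Combinatorics.Permutations"
begin

text \<open>A graph is a pair of a vertex set and a set of two-element edges.\<close>

type_synonym 'a graph = "'a set \<times> 'a set set"

abbreviation verts :: "'a graph \<Rightarrow> 'a set" where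
  "verts \<equiv> fst"

abbreviation edges :: "'a graph \<Rightarrow> 'a set set" where
  "edges \<equiv> snd"

definition simple_graph :: "'a graph \<Rightarrow> bool" where
  "simple_graph G \<longleftrightarrow> finite (verts G) \<and> (\<forall>e\<in>edges G. e \<subseteq> verts G \<and> card e = 2)"

definition subgraph :: "'a graph \<Rightarrow> 'a graph \<Rightarrow> bool" where
  "subgraph J G \<longleftrightarrow> simple_graph J \<and> verts J \<subseteq> verts G \<and> edges J \<subseteq> edges G"

definition strongly_balanced :: "real \<Rightarrow> 'a graph \<Rightarrow> bool" where
  "strongly_balanced c H \<longleftrightarrow>
     (\<forall>J. subgraph J H \<and> edges J \<noteq> {} \<longrightarrow>
        c < real (card (verts J)) \<and>
        real (card (edges J)) / (real (card (verts J)) - c)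
          \<le> real (card (edges H)) / (real (card (verts H)) - c))"

definition graph_iso :: "('a \<Rightarrow> 'b) \<Rightarrow> 'a graph \<Rightarrow> 'b graph \<Rightarrow> bool" where
  "graph_iso f G G' \<longleftrightarrow> bij_betw f (verts G) (verts G') \<and> (\<lambda>e. f ` e) ` edges G = edges G'"

text \<open>Automorphisms are taken to be the identity off the vertex set, so that each one
  is represented by exactly one function.\<close>

definition automorphisms :: "'a graph \<Rightarrow> ('a \<Rightarrow> 'a) set" where
  "automorphisms G = {f. f permutes verts G \<and> graph_iso f G G}"

definition complete_graph :: "nat \<Rightarrow> nat graph" where
  "complete_graph n = ({..<n}, {e. e \<subseteq> {..<n} \<and> card e = 2})"

definition copies :: "nat \<Rightarrow> 'a graph \<Rightarrow> nat graph set" where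
  "copies n H = {S. subgraph S (complete_graph n) \<and> (\<exists>f. graph_iso f H S)}"

definition num_copies :: "nat \<Rightarrow> 'a graph \<Rightarrow> real" where
  "num_copies n H =
     (fact n / fact (n - card (verts H))) / real (card (automorphisms H))"

definition p_1M :: "nat \<Rightarrow> 'a graph \<Rightarrow> real" where
  "p_1M n H = num_copies n H powr (- 1 / real (card (edges H)))"

text \<open>The binomial random graph on the vertex set of the complete graph, as a random edge set.\<close>

definition gnp :: "nat \<Rightarrow> real \<Rightarrow> nat set set pmf" where
  "gnp n p = map_pmf (\<lambda>x. {e \<in> edges (complete_graph n). x e})
     (Pi_pmf (edges (complete_graph n)) False (\<lambda>_. bernoulli_pmf p))"

text \<open>The joint law of the planted copy and the independent noise; the observation is a
  function of the two.\<close>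

definition planted_model :: "nat \<Rightarrow> 'a graph \<Rightarrow> real \<Rightarrow> (nat graph \<times> nat set set) pmf" where
  "planted_model n H p = pair_pmf (pmf_of_set (copies n H)) (gnp n p)"

definition planted_edge :: "nat set \<Rightarrow> nat graph \<times> nat set set \<Rightarrow> real" where
  "planted_edge e \<omega> = indicator (edges (fst \<omega>)) e"

definition observation :: "nat graph \<times> nat set set \<Rightarrow> nat set set" where
  "observation \<omega> = edges (fst \<omega>) \<union> snd \<omega>"

text \<open>Conditioning on the observation is conditioning on the sigma-algebra it generates;
  the conditional expectation of the edge vector is taken coordinatewise.\<close>

definition posterior_mean ::
    "nat \<Rightarrow> 'a graph \<Rightarrow> real \<Rightarrow> nat set \<Rightarrow> nat graph \<times> nat set set \<Rightarrow> real" where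
  "posterior_mean n H p e =
     real_cond_exp (measure_pmf (planted_model n H p))
       (vimage_algebra UNIV observation (count_space UNIV)) (planted_edge e)"

definition MMSE :: "nat \<Rightarrow> 'a graph \<Rightarrow> real \<Rightarrow> real" where
  "MMSE n H p = measure_pmf.expectation (planted_model n H p)
     (\<lambda>\<omega>. \<Sum>e\<in>edges (complete_graph n). (planted_edge e \<omega> - posterior_mean n H p e \<omega>)\<^sup>2)"

text \<open>The bounds relating the edge density to the critical probability are only required for
  all large \<open>n\<close>: for small \<open>n\<close> the critical probability may be 1 (it always is at \<open>n = 0\<close> for
  the first moment threshold), and then no density in the unit interval exceeds it by the
  factor \<open>1 + \<epsilon>\<close>.\<close>

definition exhibits_AoN :: "(nat \<Rightarrow> 'a graph) \<Rightarrow> (nat \<Rightarrow> real) \<Rightarrow> bool" where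
  "exhibits_AoN H p_AoN \<longleftrightarrow>
     (\<forall>n. p_AoN n \<in> {0..1}) \<and>
     (\<forall>\<epsilon>>0.
       (\<forall>p. (\<forall>n. p n \<in> {0..1}) \<and> (\<forall>\<^sub>F n in sequentially. p n \<ge> (1 + \<epsilon>) * p_AoN n) \<longrightarrow>
          (\<lambda>n. MMSE n (H n) (p n) / real (card (edges (H n)))) \<longlonglongrightarrow> 1) \<and>
       (\<forall>p. (\<forall>n. p n \<in> {0..1}) \<and> (\<forall>\<^sub>F n in sequentially. p n \<le> (1 - \<epsilon>) * p_AoN n) \<longrightarrow>
          (\<lambda>n. MMSE n (H n) (p n) / real (card (edges (H n)))) \<longlonglongrightarrow> 0))"

end

theory Submission imports Defs begin

text \<open>
  Write \<open>k\<close> for the number of edges of \<open>H\<close>, \<open>v\<close> for its number of vertices and \<open>M\<close> for the number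
  of copies, so that \<open>p_1M = M powr (- 1 / k)\<close>. All planted copies have the same number of edges,
  hence the likelihood of an observation is the same for every copy that it contains: the
  posterior is uniform on the copies inside \<open>Y\<close>, and the MMSE equals \<open>k\<close> minus the expected average
  overlap between the planted copy and the copies inside \<open>Y\<close> (\<open>MMSE_eq\<close>).

  Everything therefore rests on counting copies by their overlap with a fixed copy \<open>S\<close>. The claim
  (\<open>overlap_bounded\<close>) is that at most \<open>M powr (r / k)\<close> copies share exactly \<open>k - r\<close> edges with \<open>S\<close>,
  for every \<open>r\<close>, once \<open>n\<close> is large. To choose such a copy, choose the shared edge set \<open>J\<close>, then the vertices
  outside \<open>J\<close>, then the \<open>r\<close> missing edges inside the resulting vertex set. Strong balance
  limits the number of new vertices to \<open>r (v - c) / k\<close>, whereas \<open>M powr (r / k)\<close> is at least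
  \<open>(n / v) powr (r v / k)\<close>. The surplus \<open>n powr (c r / k)\<close> is, by the sparsity hypothesis, at least
  \<open>(ln n) powr (3 r (1 + v / k))\<close>, which pays for the choice of \<open>J\<close> (at most \<open>k ^ r\<close>
  ways), for the new edges (at most \<open>v ^ (2 r)\<close> ways) and for the denominator \<open>v powr (r v / k)\<close>.

  Put \<open>a = p / p_1M\<close>. Given the planted copy, a copy that misses \<open>r\<close> of its edges survives in \<open>Y\<close>
  with probability \<open>p ^ r\<close>, so the expected number of such copies in \<open>Y\<close> is at most \<open>a ^ r\<close>.

  Below the threshold \<open>a \<le> 1 - \<epsilon>\<close>, and the MMSE is at most \<open>\<Sum>r. r a ^ r\<close>, a constant; this is
  negligible compared with \<open>k\<close> (\<open>MMSE_upper\<close>).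

  Above the threshold \<open>a \<ge> 1 + \<epsilon>\<close>. Relative to \<open>M p ^ k\<close>, the mean number of copies in a random
  graph without a planted copy, the expected number of copies in \<open>Y\<close> that share \<open>j\<close> edges with the
  planted one is at most \<open>(1 / a) ^ j\<close>. So the average overlap is negligible compared with \<open>k\<close>
  unless \<open>Y\<close> contains far fewer than \<open>M p ^ k\<close> copies. Such observations are unlikely, because the
  planted law has density proportional to the number of copies (\<open>prob_few_copies_le\<close>,
  \<open>MMSE_lower\<close>).
\<close>

section \<open>The number of copies\<close>

definition graph_image :: "('a \<Rightarrow> 'b) \<Rightarrow> 'a graph \<Rightarrow> 'b graph" where
  "graph_image f G = (f ` verts G, (`) f ` edges G)"

lemma graph_iso_iff_image:
  "graph_iso f G G' \<longleftrightarrow> inj_on f (verts G) \<and> G' = graph_image f G"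
  by (auto simp: graph_iso_def graph_image_def bij_betw_def prod_eq_iff)

lemma graph_image_cong:
  assumes "simple_graph G" and "\<And>x. x \<in> verts G \<Longrightarrow> f x = g x"
  shows "graph_image f G = graph_image g G"
proof -
  have "f ` e = g ` e" if "e \<in> edges G" for e
    using assms that by (intro image_cong) (auto simp: simple_graph_def)
  then show ?thesis
    using assms(2) by (auto simp: graph_image_def prod_eq_iff intro!: image_cong)
qed

lemma graph_image_compose: "graph_image f (graph_image g G) = graph_image (f \<circ> g) G"
  by (simp add: graph_image_def image_comp comp_def)

lemma finite_edges: "simple_graph G \<Longrightarrow> finite (edges G)"
  by (rule finite_subset[of _ "Pow (verts G)"]) (auto simp: simple_graph_def)

lemma card_edges_graph_image:
  assumes "simple_graph G" "inj_on f (verts G)"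
  shows "card (edges (graph_image f G)) = card (edges G)"
proof -
  have "inj_on ((`) f) (edges G)"
    using assms by (intro inj_on_subset[OF inj_on_image_Pow]) (auto simp: simple_graph_def)
  then show ?thesis
    by (simp add: graph_image_def card_image)
qed

lemma simple_graph_image:
  assumes "simple_graph G" "inj_on f (verts G)"
  shows "simple_graph (graph_image f G)"
proof -
  have "card (f ` e) = card e" if "e \<in> edges G" for e
    using assms that by (intro card_image) (auto simp: simple_graph_def intro: inj_on_subset)
  then show ?thesis
    using assms(1) by (auto simp: simple_graph_def graph_image_def)
qed

text \<open>Extensionality makes an embedding determined by its values on the vertices, so that embeddings can
be counted.\<close>

definition embeddings :: "nat \<Rightarrow> 'a graph \<Rightarrow> ('a \<Rightarrow> nat) set" where
  "embeddings n G = {f \<in> verts G \<rightarrow>\<^sub>E {..<n}. inj_on f (verts G)}"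

lemma copies_eq_image_embeddings:
  assumes G: "simple_graph G"
  shows "copies n G = (\<lambda>f. graph_image f G) ` embeddings n G"
proof (intro set_eqI iffI)
  fix S assume "S \<in> copies n G"
  then obtain f where S: "subgraph S (complete_graph n)"
    and f: "inj_on f (verts G)" "S = graph_image f G"
    by (auto simp: copies_def graph_iso_iff_image)
  let ?g = "restrict f (verts G)"
  have "?g \<in> embeddings n G"
    using f S by (auto simp: embeddings_def subgraph_def complete_graph_def graph_image_def
        inj_on_def)
  moreover have "S = graph_image ?g G"
    using graph_image_cong[OF G, of f ?g] f by simp
  ultimately show "S \<in> (\<lambda>f. graph_image f G) ` embeddings n G"
    by blast
next
  fix S assume "S \<in> (\<lambda>f. graph_image f G) ` embeddings n G"
  then obtain f where f: "f \<in> verts G \<rightarrow>\<^sub>E {..<n}" "inj_on f (verts G)" "S = graph_image f G"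
    by (auto simp: embeddings_def)
  have S: "simple_graph S"
    using simple_graph_image[OF G f(2)] f(3) by simp
  have "verts S \<subseteq> {..<n}"
    using f by (auto simp: graph_image_def)
  then have "subgraph S (complete_graph n)"
    using S by (fastforce simp: subgraph_def complete_graph_def simple_graph_def)
  then show "S \<in> copies n G"
    using f by (auto simp: copies_def graph_iso_iff_image)
qed

text \<open>Along a fixed enumeration of the domain, injections are the same as duplicate-free lists of values.\<close>

lemma card_injections:
  fixes A :: "'a set" and B :: "'b set"
  assumes A: "finite A" and B: "finite B" and le: "card A \<le> card B"
  shows "real (card {f \<in> A \<rightarrow>\<^sub>E B. inj_on f A}) = fact (card B) / fact (card B - card A)"
proof -
  obtain xs where xs: "set xs = A" "distinct xs"
    using finite_distinct_list[OF A] by blast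
  have len: "length xs = card A"
    using xs distinct_card by fastforce
  let ?D = "{ys. length ys = card A \<and> distinct ys \<and> set ys \<subseteq> B}"
  have "bij_betw (\<lambda>f. map f xs) {f \<in> A \<rightarrow>\<^sub>E B. inj_on f A} ?D"
  proof (intro bij_betwI')
    fix f g assume "f \<in> {f \<in> A \<rightarrow>\<^sub>E B. inj_on f A}" "g \<in> {f \<in> A \<rightarrow>\<^sub>E B. inj_on f A}"
    then show "(map f xs = map g xs) = (f = g)"
      using xs by (auto intro: PiE_ext)
  next
    fix f assume "f \<in> {f \<in> A \<rightarrow>\<^sub>E B. inj_on f A}"
    then show "map f xs \<in> ?D"
      using xs len by (auto simp: distinct_map)
  next
    fix ys assume ys: "ys \<in> ?D"
    define f where "f = restrict (the \<circ> map_of (zip xs ys)) A"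
    have map: "map f xs = ys"
    proof (rule nth_equalityI)
      show "length (map f xs) = length ys" using ys len by simp
      fix i assume "i < length (map f xs)"
      then show "map f xs ! i = ys ! i"
        using ys len xs by (auto simp: f_def map_of_zip_nth)
    qed
    then have "inj_on f A" "f ` A \<subseteq> B"
      using ys xs by (auto simp: distinct_map)
    then have "f \<in> {f \<in> A \<rightarrow>\<^sub>E B. inj_on f A}"
      by (auto simp: f_def)
    with map show "\<exists>f\<in>{f \<in> A \<rightarrow>\<^sub>E B. inj_on f A}. ys = map f xs" by blast
  qed
  then have "card {f \<in> A \<rightarrow>\<^sub>E B. inj_on f A} = card ?D"
    by (rule bij_betw_same_card)
  also have "\<dots> = \<Prod>{card B - card A + 1..card B}"
    by (rule card_lists_distinct_length_eq[OF B le])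
  also have "\<dots> = fact (card B) div fact (card B - card A)"
    using fact_div_fact[of "card B - card A" "card B"] by simp
  finally show ?thesis
    by (simp add: real_of_nat_div fact_dvd)
qed

text \<open>Two embeddings with the same image differ by an automorphism, so each copy arises from the same
number of embeddings. This is what makes the formula for the first moment count the copies.\<close>

lemma card_fibre_eq_card_automorphisms:
  assumes G: "simple_graph G" and f: "f \<in> embeddings n G"
  shows "card {g \<in> embeddings n G. graph_image g G = graph_image f G} = card (automorphisms G)"
proof -
  let ?V = "verts G"
  have inj: "inj_on f ?V" and fV: "f \<in> ?V \<rightarrow>\<^sub>E {..<n}"
    using f by (auto simp: embeddings_def)
  have aut: "automorphisms G = {s. s permutes ?V \<and> graph_image s G = G}"
    by (auto simp: automorphisms_def graph_iso_iff_image permutes_inj_on)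
  have "bij_betw (\<lambda>s. restrict (f \<circ> s) ?V) (automorphisms G)
      {g \<in> embeddings n G. graph_image g G = graph_image f G}"
  proof (intro bij_betwI')
    fix s t assume st: "s \<in> automorphisms G" "t \<in> automorphisms G"
    then have s: "s permutes ?V" and t: "t permutes ?V" by (auto simp: aut)
    show "(restrict (f \<circ> s) ?V = restrict (f \<circ> t) ?V) = (s = t)"
    proof
      assume eq: "restrict (f \<circ> s) ?V = restrict (f \<circ> t) ?V"
      show "s = t"
      proof
        fix x show "s x = t x"
        proof (cases "x \<in> ?V")
          case True
          then have "f (s x) = f (t x)" using fun_cong[OF eq, of x] by simp
          then show ?thesis
            using inj True permutes_in_image[OF s] permutes_in_image[OF t] by (auto dest: inj_onD)
        qed (use s t in \<open>simp add: permutes_not_in\<close>)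
      qed
    qed simp
  next
    fix s assume "s \<in> automorphisms G"
    then have s: "s permutes ?V" "graph_image s G = G" by (auto simp: aut)
    have "graph_image (restrict (f \<circ> s) ?V) G = graph_image (f \<circ> s) G"
      by (rule graph_image_cong[OF G]) simp
    also have "\<dots> = graph_image f G"
      by (simp add: s flip: graph_image_compose)
    moreover have "inj_on (f \<circ> s) ?V"
      using inj s by (auto intro!: comp_inj_on simp: permutes_inj_on permutes_image)
    ultimately show "restrict (f \<circ> s) ?V
        \<in> {g \<in> embeddings n G. graph_image g G = graph_image f G}"
      using fV s permutes_in_image[OF s(1)] by (auto simp: embeddings_def inj_on_def)
  next
    fix g assume g: "g \<in> {g \<in> embeddings n G. graph_image g G = graph_image f G}"
    have gf: "g ` ?V = f ` ?V" and ginj: "inj_on g ?V" and gext: "g \<in> extensional ?V"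
      using g by (auto simp: graph_image_def embeddings_def PiE_def)
    define s where "s = (\<lambda>x. if x \<in> ?V then inv_into ?V f (g x) else x)"
    have s_in: "s x \<in> ?V" if "x \<in> ?V" for x
      using that gf by (auto simp: s_def intro!: inv_into_into)
    have fs: "f (s x) = g x" if "x \<in> ?V" for x
      using that gf by (auto simp: s_def intro!: f_inv_into_f)
    have "inj_on s ?V"
    proof (rule inj_onI)
      fix x y assume "x \<in> ?V" "y \<in> ?V" "s x = s y"
      then show "x = y" using fs[of x] fs[of y] inj_onD[OF ginj] by simp
    qed
    moreover have "s ` ?V \<subseteq> ?V" using s_in by blast
    moreover have "finite ?V" using G by (simp add: simple_graph_def)
    ultimately have "bij_betw s ?V ?V"
      by (simp add: bij_betw_def endo_inj_surj)
    then have perm: "s permutes ?V"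
      by (rule bij_imp_permutes) (simp add: s_def)
    have restr: "g = restrict (f \<circ> s) ?V"
      using gext fs by (intro extensionalityI[of _ ?V]) auto
    have "graph_image f (graph_image s G) = graph_image g G"
      unfolding graph_image_compose by (rule graph_image_cong[OF G]) (simp add: fs)
    also have "\<dots> = graph_image f G" using g by simp
    finally have e: "(`) f ` (`) s ` edges G = (`) f ` edges G"
      by (simp add: graph_image_def)
    have "inj_on ((`) f) (Pow ?V)" by (rule inj_on_image_Pow[OF inj])
    moreover have "(`) s ` edges G \<subseteq> Pow ?V" "edges G \<subseteq> Pow ?V"
      using G s_in by (auto simp: simple_graph_def)
    ultimately have "(`) s ` edges G = edges G"
      using e by (metis inj_on_image_eq_iff)
    then have "graph_image s G = G"
      by (simp add: graph_image_def prod_eq_iff permutes_image[OF perm])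
    with perm restr show "\<exists>s\<in>automorphisms G. g = restrict (f \<circ> s) ?V"
      by (auto simp: aut)
  qed
  then show ?thesis by (simp add: bij_betw_same_card)
qed

lemma finite_embeddings: "simple_graph G \<Longrightarrow> finite (embeddings n G)"
  unfolding embeddings_def
  by (rule finite_subset[of _ "verts G \<rightarrow>\<^sub>E {..<n}"]) (auto simp: simple_graph_def intro!: finite_PiE)

lemma finite_copies: "simple_graph G \<Longrightarrow> finite (copies n G)"
  by (simp add: copies_eq_image_embeddings finite_embeddings)

lemma card_automorphisms_bounds:
  assumes "simple_graph G"
  shows "0 < card (automorphisms G)" "card (automorphisms G) \<le> fact (card (verts G))"
proof -
  have fin: "finite (verts G)" using assms by (simp add: simple_graph_def)
  have sub: "automorphisms G \<subseteq> {s. s permutes verts G}"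
    by (auto simp: automorphisms_def)
  have "id \<in> automorphisms G"
    by (simp add: automorphisms_def graph_iso_def permutes_id)
  then show "0 < card (automorphisms G)"
    using finite_subset[OF sub finite_permutations[OF fin]] by (auto simp: card_gt_0_iff)
  show "card (automorphisms G) \<le> fact (card (verts G))"
    using card_mono[OF finite_permutations[OF fin] sub] card_permutations[OF refl fin] by simp
qed

lemma card_copies_eq_num_copies:
  assumes G: "simple_graph G" and le: "card (verts G) \<le> n"
  shows "real (card (copies n G)) = num_copies n G"
proof -
  have "card (embeddings n G)
      = (\<Sum>S\<in>copies n G. card {g \<in> embeddings n G. graph_image g G = S})"
    unfolding copies_eq_image_embeddings[OF G]
    using sum.image_gen[OF finite_embeddings[OF G], of "\<lambda>_. 1 :: nat" n "\<lambda>f. graph_image f G"]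
    by simp
  also have "\<dots> = (\<Sum>S\<in>copies n G. card (automorphisms G))"
    by (rule sum.cong)
      (auto simp: copies_eq_image_embeddings[OF G] card_fibre_eq_card_automorphisms[OF G])
  finally have "real (card (embeddings n G)) = real (card (copies n G)) * real (card (automorphisms G))"
    by simp
  moreover have "real (card (embeddings n G)) = fact n / fact (n - card (verts G))"
    using card_injections[of "verts G" "{..<n}"] G le by (simp add: embeddings_def simple_graph_def)
  ultimately show ?thesis
    using card_automorphisms_bounds(1)[OF G] by (simp add: num_copies_def field_simps)
qed

lemma num_copies_ge_binomial:
  assumes "simple_graph G" "card (verts G) \<le> n"
  shows "real (n choose card (verts G)) \<le> num_copies n G"
proof -
  let ?v = "card (verts G)"
  have "real (n choose ?v) = fact n / fact (n - ?v) / fact ?v"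
    using binomial_fact[OF assms(2), where 'a = real] by (simp add: field_simps)
  also have "\<dots> \<le> num_copies n G"
    unfolding num_copies_def
  proof (rule divide_left_mono)
    show "real (card (automorphisms G)) \<le> fact ?v"
      using card_automorphisms_bounds(2)[OF assms(1)] by (metis of_nat_fact of_nat_mono)
    show "0 < (fact ?v :: real) * real (card (automorphisms G))"
      using card_automorphisms_bounds(1)[OF assms(1)] by simp
  qed simp
  finally show ?thesis .
qed

lemma copy_facts:
  assumes "S \<in> copies n G" "simple_graph G"
  shows "simple_graph S" "verts S \<subseteq> {..<n}" "edges S \<subseteq> edges (complete_graph n)"
    "card (verts S) = card (verts G)" "card (edges S) = card (edges G)" "finite (edges S)"
proof -
  obtain f where "inj_on f (verts G)" "S = graph_image f G" and s: "subgraph S (complete_graph n)"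
    using assms by (auto simp: copies_def graph_iso_iff_image)
  then show "card (verts S) = card (verts G)" "card (edges S) = card (edges G)"
    using card_edges_graph_image[OF assms(2)] by (auto simp: graph_image_def card_image)
  show "simple_graph S" "verts S \<subseteq> {..<n}" "edges S \<subseteq> edges (complete_graph n)"
    "finite (edges S)"
    using s finite_edges[of S] by (auto simp: subgraph_def complete_graph_def)
qed

section \<open>Counting copies by their overlap with a fixed copy\<close>

lemma binomial_le_power: "n choose k \<le> n ^ k"
  by (cases "k \<le> n") (auto simp: binomial_le_pow binomial_eq_0)

text \<open>A copy that contains \<open>J\<close> is determined by its vertices outside \<open>J\<close> and its \<open>r\<close> edges outside \<open>J\<close>;
the latter are pairs from a vertex set of size at most \<open>card (verts G)\<close>.\<close>

lemma card_copies_containing_le: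
  assumes G: "simple_graph G" and J: "J \<subseteq> edges (complete_graph n)"
    and cJ: "card J + r = card (edges G)" and vJ: "card (\<Union>J) \<le> card (verts G)"
  shows "card {S \<in> copies n G. J \<subseteq> edges S}
    \<le> n ^ (card (verts G) - card (\<Union>J)) * ((card (verts G))\<^sup>2) ^ r"
proof -
  let ?v = "card (verts G)"
  define P where "P U = {e. e \<subseteq> U \<union> \<Union>J \<and> card e = 2}" for U
  let ?U = "{U. U \<subseteq> {..<n} \<and> card U = ?v - card (\<Union>J)}"
  let ?T = "Sigma ?U (\<lambda>U. {F. F \<subseteq> P U \<and> card F = r})"
  have UJ: "\<Union>J \<subseteq> {..<n}" using J by (auto simp: complete_graph_def)
  have finUJ: "finite (\<Union>J)" by (rule finite_subset[OF UJ]) simp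
  have finJ: "finite J"
    by (rule finite_subset[OF J], rule finite_subset[of _ "Pow {..<n}"])
      (auto simp: complete_graph_def)
  have finP: "finite (P U)" if "U \<in> ?U" for U
    unfolding P_def
    by (rule finite_subset[of _ "Pow (U \<union> \<Union>J)"])
      (use that finUJ in \<open>auto intro: finite_subset[of U "{..<n}"]\<close>)
  have finT: "finite ?T"
    by (intro finite_SigmaI) (auto simp: finP)
  have inj: "inj_on (\<lambda>S. (verts S - \<Union>J, edges S - J)) {S \<in> copies n G. J \<subseteq> edges S}"
  proof (rule inj_onI)
    fix S T
    assume S: "S \<in> {S \<in> copies n G. J \<subseteq> edges S}" and T: "T \<in> {S \<in> copies n G. J \<subseteq> edges S}"
      and eq: "(verts S - \<Union>J, edges S - J) = (verts T - \<Union>J, edges T - J)"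
    have V: "\<Union>J \<subseteq> verts R" if "R \<in> {S \<in> copies n G. J \<subseteq> edges S}" for R
    proof -
      have "R \<in> copies n G" "J \<subseteq> edges R" using that by auto
      then show ?thesis using copy_facts(1)[of R n G] G unfolding simple_graph_def by blast
    qed
    have "verts S = (verts S - \<Union>J) \<union> \<Union>J" "verts T = (verts T - \<Union>J) \<union> \<Union>J"
      using V[OF S] V[OF T] by blast+
    moreover have "edges S = (edges S - J) \<union> J" "edges T = (edges T - J) \<union> J"
      using S T by blast+
    ultimately have "verts S = verts T" "edges S = edges T"
      using eq by auto
    then show "S = T" by (simp add: prod_eq_iff)
  qed
  have sub: "(\<lambda>S. (verts S - \<Union>J, edges S - J)) ` {S \<in> copies n G. J \<subseteq> edges S} \<subseteq> ?T"
  proof (intro image_subsetI, clarsimp, intro conjI)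
    fix W F assume S: "(W, F) \<in> copies n G" and JF: "J \<subseteq> F"
    note S' = copy_facts[OF S G, simplified]
    have "\<Union>J \<subseteq> W"
      using S'(1) JF unfolding simple_graph_def by auto
    then show "card (W - \<Union>J) = ?v - card (\<Union>J)"
      using S'(4) finUJ by (simp add: card_Diff_subset)
    show "W - \<Union>J \<subseteq> {..<n}" using S'(2) by auto
    show "card (F - J) = r"
      using S'(5) cJ JF finJ by (simp add: card_Diff_subset)
    show "F - J \<subseteq> P (W - \<Union>J)"
      using S'(1) unfolding simple_graph_def P_def by auto
  qed
  have P_card: "card {F. F \<subseteq> P U \<and> card F = r} \<le> (?v\<^sup>2) ^ r" if "U \<in> ?U" for U
  proof -
    have "card (P U) = card (U \<union> \<Union>J) choose 2"
      unfolding P_def using that finUJ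
      by (intro n_subsets) (auto intro: finite_subset[of U "{..<n}"])
    also have "\<dots> \<le> card (U \<union> \<Union>J) ^ 2" by (rule binomial_le_power)
    also have "\<dots> \<le> ?v\<^sup>2"
      using card_Un_le[of U "\<Union>J"] that vJ by (intro power_mono) auto
    finally have "card (P U) \<le> ?v\<^sup>2" .
    then have "card (P U) ^ r \<le> (?v\<^sup>2) ^ r" by (rule power_mono) simp
    then show ?thesis
      using binomial_le_power[of "card (P U)" r] by (simp add: n_subsets[OF finP[OF that]])
  qed
  have "card {S \<in> copies n G. J \<subseteq> edges S} \<le> card ?T"
    by (rule card_inj_on_le[OF inj sub finT])
  also have "\<dots> = (\<Sum>U\<in>?U. card {F. F \<subseteq> P U \<and> card F = r})"
    by (rule card_SigmaI) (auto simp: finP)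
  also have "\<dots> \<le> card ?U * (?v\<^sup>2) ^ r"
    using sum_bounded_above[of ?U "\<lambda>U. card {F. F \<subseteq> P U \<and> card F = r}"] P_card by simp
  also have "card ?U \<le> n ^ (?v - card (\<Union>J))"
    using n_subsets[of "{..<n}"] binomial_le_power by simp
  finally show ?thesis by simp
qed

text \<open>Strong balance is invariant under isomorphism and may be applied to the subgraph spanned by a set of
edges. The conclusion is cleared of denominators for the counting below.\<close>

lemma strongly_balanced_copy:
  assumes G: "simple_graph G" and bal: "strongly_balanced c G"
    and S: "S \<in> copies n G" and J: "J \<subseteq> edges S" "J \<noteq> {}"
  shows "c < real (card (\<Union>J))" "card (\<Union>J) \<le> card (verts G)"
    "real (card J) * (real (card (verts G)) - c)
      \<le> real (card (edges G)) * (real (card (\<Union>J)) - c)"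
proof -
  obtain f where f: "inj_on f (verts G)" "S = graph_image f G"
    using S by (auto simp: copies_def graph_iso_iff_image)
  define J' where "J' = {e \<in> edges G. f ` e \<in> J}"
  have J'G: "J' \<subseteq> edges G" by (auto simp: J'_def)
  have J': "J = (`) f ` J'"
    using J f by (auto simp: J'_def graph_image_def)
  have VG: "\<Union>J' \<subseteq> verts G" "J' \<subseteq> Pow (verts G)"
    using G J'G by (auto simp: simple_graph_def)
  have finG: "finite (verts G)" using G by (simp add: simple_graph_def)
  have "\<Union>J = f ` \<Union>J'" by (auto simp: J')
  then have cV: "card (\<Union>J) = card (\<Union>J')"
    using VG f by (auto intro!: card_image intro: inj_on_subset)
  have cE: "card J = card J'"
    unfolding J' using inj_on_subset[OF inj_on_image_Pow[OF f(1)] VG(2)] by (rule card_image)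
  have "subgraph (\<Union>J', J') G"
    using G J'G VG finite_subset[OF VG(1) finG] by (auto simp: subgraph_def simple_graph_def)
  moreover have "J' \<noteq> {}" using J J' by auto
  ultimately have *: "c < real (card (\<Union>J'))"
    "real (card J') / (real (card (\<Union>J')) - c)
      \<le> real (card (edges G)) / (real (card (verts G)) - c)"
    using bal by (auto simp: strongly_balanced_def)
  show "c < real (card (\<Union>J))" using * cV by simp
  show le: "card (\<Union>J) \<le> card (verts G)"
    unfolding cV by (rule card_mono[OF finG VG(1)])
  show "real (card J) * (real (card (verts G)) - c)
      \<le> real (card (edges G)) * (real (card (\<Union>J)) - c)"
    using * le cV cE by (simp add: divide_simps mult.commute split: if_splits)
qed

text \<open>The left-hand side bounds the number of copies that share exactly \<open>k - r\<close> edges, spanning \<open>u\<close>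
vertices, with a given one. After taking logarithms the balance condition leaves a factor \<open>r\<close> times
the defect in the sparsity condition.\<close>

lemma power_bound_by_num_copies:
  fixes k v u n r :: nat and c M :: real
  assumes "0 < k" "0 < v" "v \<le> n" "u \<le> v" "r \<le> k"
    and bal: "real (k - r) * (real v - c) \<le> real k * (real u - c)"
    and M: "real (n choose v) \<le> M"
    and sparse: "ln k + 2 * ln v + v / k * ln v \<le> c / k * ln n"
  shows "real (k ^ r * (n ^ (v - u) * (v\<^sup>2) ^ r)) \<le> M powr (r / k)"
proof -
  have n: "0 < n" using assms by simp
  have "real k * (real v - real u) \<le> real r * (real v - c)"
    using bal \<open>r \<le> k\<close> by (simp add: of_nat_diff algebra_simps)
  then have vu: "real (v - u) \<le> real r * (real v - c) / real k"
    using assms by (simp add: of_nat_diff field_simps)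
  have "ln (real (k ^ r * (n ^ (v - u) * (v\<^sup>2) ^ r)))
      = real r * ln k + (real (v - u) * ln n + real r * (2 * ln v))"
    using assms n by (simp add: ln_mult ln_realpow)
  also have "\<dots> \<le> real r * ln k + (real r * (real v - c) / real k * ln n + real r * (2 * ln v))"
    using vu n by (intro add_mono mult_right_mono order_refl) auto
  also have "\<dots> = real r * (ln k + 2 * ln v + v / k * ln v - c / k * ln n)
      + real r * (v / k) * (ln n - ln v)"
    using assms by (simp add: field_simps)
  also have "\<dots> \<le> real r * (v / k) * (ln n - ln v)"
    using sparse by (simp add: mult_nonneg_nonpos)
  also have "\<dots> = ln (((real n / real v) ^ v) powr (r / k))"
    using assms n by (simp add: ln_powr ln_realpow ln_div)
  finally have "real (k ^ r * (n ^ (v - u) * (v\<^sup>2) ^ r)) \<le> ((real n / real v) ^ v) powr (r / k)"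
    using assms n by (subst (asm) ln_le_cancel_iff) auto
  also have "\<dots> \<le> M powr (r / k)"
    using M binomial_ge_n_over_k_pow_k[OF \<open>v \<le> n\<close>, where 'a = real]
    by (intro powr_mono2) auto
  finally show ?thesis .
qed

text \<open>At the first moment threshold the bound says that, for every \<open>r\<close>, the expected number of copies
missing exactly \<open>r\<close> edges of the planted one is at most 1.\<close>

definition overlap_bounded :: "nat \<Rightarrow> 'a graph \<Rightarrow> bool" where
  "overlap_bounded n G \<longleftrightarrow>
     (\<forall>S\<in>copies n G. \<forall>r\<le>card (edges G).
        real (card {T \<in> copies n G. card (edges S \<inter> edges T) = card (edges G) - r})
          \<le> num_copies n G powr (r / card (edges G)))"

lemma overlap_bounded_if_sparse:
  assumes G: "simple_graph G" and le: "card (verts G) \<le> n" and bal: "strongly_balanced c G"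
    and pos: "0 < card (edges G)" "0 < card (verts G)"
    and sparse: "ln (card (edges G)) + 2 * ln (card (verts G))
        + card (verts G) / card (edges G) * ln (card (verts G)) \<le> c / card (edges G) * ln n"
  shows "overlap_bounded n G"
  unfolding overlap_bounded_def
proof (intro ballI allI impI)
  let ?k = "card (edges G)" and ?v = "card (verts G)" and ?M = "num_copies n G"
  fix S r assume S: "S \<in> copies n G" and r: "r \<le> ?k"
  note S' = copy_facts[OF S G]
  let ?N = "{T \<in> copies n G. card (edges S \<inter> edges T) = ?k - r}"
  show "real (card ?N) \<le> ?M powr (r / ?k)"
  proof (cases "r = ?k")
    case True
    have "card ?N \<le> card (copies n G)"
      by (intro card_mono finite_copies[OF G]) auto
    then show ?thesis
      using True pos card_copies_eq_num_copies[OF G le] by simp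
  next
    case False
    \<comment> \<open>A share of the target that leaves room for the at most \<open>k ^ r\<close> choices of the common edge set.\<close>
    define b where "b = ?M powr (r / ?k) / real (?k ^ r)"
    let ?J = "{J. J \<subseteq> edges S \<and> card J = ?k - r}"
    have cJ: "card ?J = ?k choose r"
      using n_subsets[OF S'(6)] S'(5) binomial_symmetric[OF r] by simp
    have finJ: "finite ?J" using S'(6) by simp
    have each: "real (card {T \<in> copies n G. J \<subseteq> edges T}) \<le> b" if J: "J \<in> ?J" for J
    proof -
      have "J \<noteq> {}" using J False r by auto
      then have bJ: "card (\<Union>J) \<le> ?v" "real (card J) * (?v - c) \<le> ?k * (card (\<Union>J) - c)"
        using strongly_balanced_copy[OF G bal S, of J] J by auto
      have "card {T \<in> copies n G. J \<subseteq> edges T}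
          \<le> n ^ (?v - card (\<Union>J)) * (?v\<^sup>2) ^ r"
        using card_copies_containing_le[OF G _ _ bJ(1), of n r] J S'(3) r by auto
      then have "real (?k ^ r * card {T \<in> copies n G. J \<subseteq> edges T})
          \<le> real (?k ^ r * (n ^ (?v - card (\<Union>J)) * (?v\<^sup>2) ^ r))"
        by (rule of_nat_mono[OF mult_le_mono2])
      also have "\<dots> \<le> ?M powr (r / ?k)"
        using power_bound_by_num_copies[OF pos le bJ(1) r _ num_copies_ge_binomial[OF G le] sparse]
          bJ(2) J by auto
      finally have "real (?k ^ r) * real (card {T \<in> copies n G. J \<subseteq> edges T}) \<le> ?M powr (r / ?k)"
        by (simp only: of_nat_mult)
      then show ?thesis
        using pos by (simp add: b_def pos_le_divide_eq mult.commute)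
    qed
    have "?N \<subseteq> (\<Union>J\<in>?J. {T \<in> copies n G. J \<subseteq> edges T})"
      by auto
    then have "card ?N \<le> card (\<Union>J\<in>?J. {T \<in> copies n G. J \<subseteq> edges T})"
      by (intro card_mono) (auto simp: finJ finite_copies[OF G])
    also have "\<dots> \<le> (\<Sum>J\<in>?J. card {T \<in> copies n G. J \<subseteq> edges T})"
      by (rule card_UN_le[OF finJ])
    finally have "real (card ?N) \<le> real (\<Sum>J\<in>?J. card {T \<in> copies n G. J \<subseteq> edges T})"
      by (rule of_nat_mono)
    also have "\<dots> = (\<Sum>J\<in>?J. real (card {T \<in> copies n G. J \<subseteq> edges T}))"
      by (rule of_nat_sum)
    also have "\<dots> \<le> real (card ?J) * b"
      by (rule sum_bounded_above) (rule each)
    also have "\<dots> \<le> real (?k ^ r) * b"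
      unfolding cJ
      by (rule mult_right_mono[OF of_nat_mono[OF binomial_le_power]]) (simp add: b_def)
    also have "\<dots> = ?M powr (r / ?k)" using pos by (simp add: b_def)
    finally show ?thesis .
  qed
qed

text \<open>The hypothesis on \<open>v + k\<close> gives \<open>c ln n / k \<ge> 3 ln (ln n) (1 + v / k)\<close>. Since \<open>v\<close> and \<open>k\<close> are also
at most \<open>ln n\<close>, each logarithm on the left is at most \<open>ln (ln n)\<close>. The factor 3 is consumed by one
\<open>ln k\<close> and two \<open>ln v\<close>; the part with \<open>v / k\<close> covers the third summand.\<close>

lemma eventually_sparse:
  fixes v k :: "nat \<Rightarrow> nat" and c :: real
  assumes "c > 0" and pos: "\<forall>\<^sub>F n in sequentially. 0 < v n" "\<forall>\<^sub>F n in sequentially. 0 < k n"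
    and "\<forall>\<^sub>F n in sequentially. real (v n + k n) \<le> c * ln (real n) / (3 * ln (ln (real n)))"
  shows "\<forall>\<^sub>F n in sequentially.
    ln (k n) + 2 * ln (v n) + v n / k n * ln (v n) \<le> c / k n * ln n"
proof -
  have "filterlim (\<lambda>n::nat. ln (ln (real n))) at_top sequentially"
    by (intro filterlim_compose[OF ln_at_top] filterlim_real_sequentially)
  then have "\<forall>\<^sub>F n in sequentially. max 1 (c / 3) \<le> ln (ln (real n))"
    by (rule filterlim_at_top[THEN iffD1, rule_format])
  moreover have "\<forall>\<^sub>F n in sequentially. 0 < ln (real n)"
    by (intro eventually_compose_filterlim[OF eventually_gt_at_top]
        filterlim_compose[OF ln_at_top] filterlim_real_sequentially)
  ultimately show ?thesis
    using pos assms(4)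
  proof eventually_elim
    case (elim n)
    define x y where "x = ln (real n)" and "y = ln x"
    have y: "1 \<le> y" "c / 3 \<le> y" and x: "0 < x" using elim by (auto simp: x_def y_def)
    have q: "real (v n) + real (k n) \<le> c * x / (3 * y)"
      using elim by (simp add: x_def y_def)
    then have s: "(real (v n) + real (k n)) * (3 * y) \<le> c * x"
      using y by (subst (asm) pos_le_divide_eq) auto
    have "c * x \<le> (3 * y) * x"
      using y x by (intro mult_right_mono) auto
    then have "c * x / (3 * y) \<le> x"
      using y by (subst pos_divide_le_eq) (auto simp: mult.commute)
    with q have "real (v n) + real (k n) \<le> x" by linarith
    then have "real (v n) \<le> x" "real (k n) \<le> x" by auto
    then have l: "ln (v n) \<le> y" "ln (k n) \<le> y"
      using elim by (auto simp: y_def)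
    have vk: "0 \<le> real (v n) / real (k n)" by simp
    have "ln (k n) + 2 * ln (v n) + v n / k n * ln (v n) \<le> y + 2 * y + v n / k n * y"
      using l vk by (intro add_mono mult_left_mono) auto
    also have "\<dots> \<le> (real (v n) + real (k n)) * (3 * y) / k n"
      using elim y by (simp add: field_simps)
    also have "\<dots> \<le> c * x / k n"
      using s by (rule divide_right_mono) simp
    finally show ?case by (simp add: x_def)
  qed
qed

section \<open>The posterior distribution\<close>

lemma finite_edges_complete_graph: "finite (edges (complete_graph n))"
  by (rule finite_subset[of _ "Pow {..<n}"]) (auto simp: complete_graph_def)

lemma set_pmf_gnp: "set_pmf (gnp n p) \<subseteq> Pow (edges (complete_graph n))"
  by (auto simp: gnp_def)

lemma finite_set_pmf_gnp: "finite (set_pmf (gnp n p))"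
  by (rule finite_subset[OF set_pmf_gnp]) (simp add: finite_edges_complete_graph)

text \<open>The two instances needed are the trace of the noise off the planted copy, which determines the
observation, and the event that the noise contains given edges.\<close>

lemma prob_gnp_Int:
  assumes p: "p \<in> {0..1}" and T: "T \<subseteq> edges (complete_graph n)" and R: "R \<subseteq> T"
  shows "measure_pmf.prob (gnp n p) {X. X \<inter> T = R} = p ^ card R * (1 - p) ^ (card T - card R)"
proof -
  let ?E = "edges (complete_graph n)"
  define B where "B e = (if e \<in> T then {e \<in> R} else UNIV)" for e
  have finE: "finite ?E" by (rule finite_edges_complete_graph)
  have finT: "finite T" "finite R" using finE T R by (auto intro: finite_subset)
  have "(\<lambda>x. {e \<in> ?E. x e}) -` {X. X \<inter> T = R} = Pi ?E B"
    using T R by (auto simp: B_def Pi_def split: if_splits)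
  then have "measure_pmf.prob (gnp n p) {X. X \<inter> T = R}
      = (\<Prod>e\<in>?E. measure_pmf.prob (bernoulli_pmf p) (B e))"
    by (simp add: gnp_def measure_Pi_pmf_Pi finE)
  also have "\<dots> = (\<Prod>e\<in>?E. if e \<in> T then if e \<in> R then p else 1 - p else 1)"
    using p by (intro prod.cong) (auto simp: B_def measure_pmf_single)
  also have "\<dots> = (\<Prod>e\<in>T. if e \<in> R then p else 1 - p)"
    using T finE by (simp add: prod.If_cases Int_absorb1)
  also have "\<dots> = p ^ card R * (1 - p) ^ (card T - card R)"
    using finT R by (simp add: prod.If_cases Int_absorb1 card_Diff_subset Diff_eq[symmetric])
  finally show ?thesis .
qed

lemma prob_gnp_superset:
  assumes "p \<in> {0..1}" and R: "R \<subseteq> edges (complete_graph n)"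
  shows "measure_pmf.prob (gnp n p) {X. R \<subseteq> X} = p ^ card R"
proof -
  have "{X. R \<subseteq> X} = {X. X \<inter> R = R}" by auto
  then show ?thesis using prob_gnp_Int[OF assms order_refl] by simp
qed

lemma sum_indicator_real: "finite A \<Longrightarrow> (\<Sum>x\<in>A. indicator B x) = real (card (A \<inter> B))"
  by (simp add: indicator_def of_bool_def sum.If_cases)

locale planted =
  fixes n :: nat and G :: "'a graph" and p :: real
  assumes simple: "simple_graph G" and card_verts_le: "card (verts G) \<le> n"
    and p01: "p \<in> {0..1}"
begin

abbreviation "E \<equiv> edges (complete_graph n)"
abbreviation "C \<equiv> copies n G"
abbreviation "k \<equiv> card (edges G)"

definition copies_in :: "nat set set \<Rightarrow> nat graph set" where
  "copies_in Y = {T \<in> C. edges T \<subseteq> Y}"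

text \<open>The probability of observing \<open>Y\<close> when the planted copy is a given copy inside \<open>Y\<close>. It does not
depend on that copy.\<close>

definition weight :: "nat set set \<Rightarrow> real" where
  "weight Y = p ^ (card Y - k) * (1 - p) ^ (card E - card Y)"

lemma num_copies_pos: "0 < num_copies n G"
proof -
  have "0 < n choose card (verts G)" using card_verts_le by simp
  then have "0 < real (n choose card (verts G))" by simp
  then show ?thesis using num_copies_ge_binomial[OF simple card_verts_le] by linarith
qed

lemma card_C: "real (card C) = num_copies n G"
  by (rule card_copies_eq_num_copies[OF simple card_verts_le])

lemma finite_C: "finite C" by (rule finite_copies[OF simple])

lemma C_nonempty: "C \<noteq> {}"
  using card_C num_copies_pos by auto

lemmas copy = copy_facts[OF _ simple]

lemma finite_copies_in: "finite (copies_in Y)"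
  using finite_C by (simp add: copies_in_def)

lemma finite_set_pmf_planted: "finite (set_pmf (planted_model n G p))"
  by (simp add: planted_model_def finite_C C_nonempty finite_set_pmf_gnp)

lemma integrable_planted: "integrable (measure_pmf (planted_model n G p)) (f :: _ \<Rightarrow> real)"
  by (rule integrable_measure_pmf_finite[OF finite_set_pmf_planted])

lemma planted_support:
  assumes "\<omega> \<in> set_pmf (planted_model n G p)"
  shows "fst \<omega> \<in> C" "fst \<omega> \<in> copies_in (observation \<omega>)"
  using assms by (auto simp: planted_model_def finite_C C_nonempty copies_in_def observation_def)

lemma expectation_planted:
  fixes f :: "nat graph \<times> nat set set \<Rightarrow> real"
  shows "measure_pmf.expectation (planted_model n G p) f
    = (\<Sum>S\<in>C. measure_pmf.expectation (gnp n p) (\<lambda>X. f (S, X))) / card C"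
proof -
  have "planted_model n G p = pmf_of_set C \<bind> (\<lambda>S. map_pmf (Pair S) (gnp n p))"
    by (simp add: planted_model_def pair_pmf_def map_pmf_def)
  then show ?thesis
    by (simp add: pmf_expectation_bind_pmf_of_set C_nonempty finite_C finite_set_pmf_gnp
        sum_divide_distrib divide_inverse sum_distrib_left sum_distrib_right mult.commute)
qed

lemma expectation_mono_planted:
  fixes f g :: "nat graph \<times> nat set set \<Rightarrow> real"
  assumes "\<And>\<omega>. \<omega> \<in> set_pmf (planted_model n G p) \<Longrightarrow> f \<omega> \<le> g \<omega>"
  shows "measure_pmf.expectation (planted_model n G p) f
    \<le> measure_pmf.expectation (planted_model n G p) g"
  using assms by (intro integral_mono_AE integrable_planted) (simp add: AE_measure_pmf_iff)

lemma expectation_cong_planted: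
  fixes f g :: "nat graph \<times> nat set set \<Rightarrow> real"
  assumes "\<And>\<omega>. \<omega> \<in> set_pmf (planted_model n G p) \<Longrightarrow> f \<omega> = g \<omega>"
  shows "measure_pmf.expectation (planted_model n G p) f
    = measure_pmf.expectation (planted_model n G p) g"
  using assms by (intro integral_cong_AE) (simp_all add: AE_measure_pmf_iff)

text \<open>The planted edges are observed in any case, so the observation is \<open>Y\<close> exactly if the noise agrees
with \<open>Y\<close> off the planted copy.\<close>

lemma prob_union_eq:
  assumes S: "S \<in> C" and Y: "Y \<subseteq> E"
  shows "measure_pmf.prob (gnp n p) {X. edges S \<union> X = Y} = (if edges S \<subseteq> Y then weight Y else 0)"
proof (cases "edges S \<subseteq> Y")
  case True
  note S' = copy[OF S]
  have finY: "finite Y" using Y finite_edges_complete_graph finite_subset by blast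
  have "measure_pmf.prob (gnp n p) {X. edges S \<union> X = Y}
      = measure_pmf.prob (gnp n p) {X. X \<inter> (E - edges S) = Y - edges S}"
  proof (rule measure_prob_cong_0)
    fix X assume X: "X \<in> {X. edges S \<union> X = Y} - {X. X \<inter> (E - edges S) = Y - edges S}"
    then show "pmf (gnp n p) X = 0" using Y by auto
  next
    fix X assume X: "X \<in> {X. X \<inter> (E - edges S) = Y - edges S} - {X. edges S \<union> X = Y}"
    then have "\<not> X \<subseteq> E" using True by auto
    then show "pmf (gnp n p) X = 0" using set_pmf_gnp[of n p] by (auto simp: pmf_eq_0_set_pmf)
  qed
  also have "\<dots> = p ^ card (Y - edges S) * (1 - p) ^ (card (E - edges S) - card (Y - edges S))"
    by (rule prob_gnp_Int[OF p01]) (use Y in auto)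
  also have "card (Y - edges S) = card Y - k"
    using True S' by (simp add: card_Diff_subset)
  also have "card (E - edges S) = card E - k"
    using S' by (simp add: card_Diff_subset)
  also have "card E - k - (card Y - k) = card E - card Y"
    using card_mono[OF finY True] S' by simp
  finally show ?thesis using True by (simp add: weight_def)
next
  case False
  then have "{X. edges S \<union> X = Y} = {}" by auto
  then show ?thesis using False by simp
qed

text \<open>The joint law of the planted copy and the observation: as the likelihood does not depend on the copy,
all copies inside \<open>Y\<close> are equally likely given \<open>Y\<close>.\<close>

lemma expectation_observed:
  "measure_pmf.expectation (planted_model n G p) (\<lambda>\<omega>. h (fst \<omega>) (observation \<omega>))
    = (\<Sum>Y\<in>Pow E. weight Y * (\<Sum>S\<in>copies_in Y. h S Y)) / card C"
proof -
  have *: "measure_pmf.expectation (gnp n p) (\<lambda>X. h S (edges S \<union> X))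
      = (\<Sum>Y\<in>Pow E. h S Y * (if edges S \<subseteq> Y then weight Y else 0))" if S: "S \<in> C" for S
  proof -
    have "measure_pmf.expectation (gnp n p) (\<lambda>X. h S (edges S \<union> X))
        = measure_pmf.expectation (map_pmf (\<lambda>X. edges S \<union> X) (gnp n p)) (h S)" by simp
    also have "\<dots> = (\<Sum>Y\<in>Pow E. h S Y * pmf (map_pmf (\<lambda>X. edges S \<union> X) (gnp n p)) Y)"
      using copy(3)[OF S] set_pmf_gnp[of n p] finite_edges_complete_graph
      by (intro integral_measure_pmf_real) auto
    also have "\<dots> = (\<Sum>Y\<in>Pow E. h S Y * (if edges S \<subseteq> Y then weight Y else 0))"
    proof (rule sum.cong)
      fix Y assume "Y \<in> Pow E"
      then show "h S Y * pmf (map_pmf (\<lambda>X. edges S \<union> X) (gnp n p)) Y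
          = h S Y * (if edges S \<subseteq> Y then weight Y else 0)"
        using prob_union_eq[OF S, of Y] by (simp add: pmf_map vimage_def)
    qed simp
    finally show ?thesis .
  qed
  have "(\<Sum>S\<in>C. measure_pmf.expectation (gnp n p) (\<lambda>X. h S (edges S \<union> X)))
      = (\<Sum>Y\<in>Pow E. \<Sum>S\<in>C. h S Y * (if edges S \<subseteq> Y then weight Y else 0))"
    using * by (simp add: sum.swap[of _ _ C])
  also have "\<dots> = (\<Sum>Y\<in>Pow E. weight Y * (\<Sum>S\<in>copies_in Y. h S Y))"
  proof (rule sum.cong)
    fix Y
    have "(\<Sum>S\<in>C. h S Y * (if edges S \<subseteq> Y then weight Y else 0)) = (\<Sum>S\<in>copies_in Y. h S Y * weight Y)"
      unfolding copies_in_def by (subst sum.inter_filter[OF finite_C]) (auto intro!: sum.cong)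
    then show "(\<Sum>S\<in>C. h S Y * (if edges S \<subseteq> Y then weight Y else 0))
        = weight Y * (\<Sum>S\<in>copies_in Y. h S Y)"
      by (simp add: sum_distrib_left mult.commute)
  qed simp
  finally show ?thesis
    by (simp add: expectation_planted observation_def)
qed

definition posterior :: "nat set \<Rightarrow> nat set set \<Rightarrow> real" where
  "posterior e Y = (\<Sum>T\<in>copies_in Y. indicator (edges T) e) / card (copies_in Y)"

abbreviation obs_algebra :: "(nat graph \<times> nat set set) measure" where
  "obs_algebra \<equiv> vimage_algebra UNIV observation (count_space UNIV)"

lemma finite_measure_subalgebra_obs:
  "finite_measure_subalgebra (measure_pmf (planted_model n G p)) obs_algebra"
  by (intro finite_measure_subalgebra.intro measure_pmf.finite_measure_axioms
      finite_measure_subalgebra_axioms.intro) (simp add: subalgebra_def)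

lemma borel_measurable_obs: "(\<lambda>\<omega>. g (observation \<omega>)) \<in> borel_measurable obs_algebra"
  for g :: "nat set set \<Rightarrow> real"
  by (rule measurable_compose[OF measurable_vimage_algebra1]) auto

text \<open>Averaging over the copies inside \<open>Y\<close> does not change the sum over these copies, which is the defining
property of the conditional expectation by the formula for the joint law.\<close>

lemma posterior_mean_eq:
  "AE \<omega> in measure_pmf (planted_model n G p).
    posterior_mean n G p e \<omega> = posterior e (observation \<omega>)"
  unfolding posterior_mean_def
proof (rule sigma_finite_subalgebra.real_cond_exp_charact)
  show "sigma_finite_subalgebra (measure_pmf (planted_model n G p)) obs_algebra"
    by (rule finite_measure_subalgebra_is_sigma_finite[OF finite_measure_subalgebra_obs])
  fix A assume "A \<in> sets obs_algebra"
  then obtain B where A: "A = observation -` B"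
    by (auto simp: sets_vimage_algebra2)
  have sum_eq: "(\<Sum>S\<in>copies_in Y. indicator B Y * indicator (edges S) e)
      = (\<Sum>S\<in>copies_in Y. indicator B Y * posterior e Y)" for Y
    using finite_copies_in[of Y]
    by (cases "copies_in Y = {}") (simp_all add: posterior_def flip: sum_distrib_left)
  have "measure_pmf.expectation (planted_model n G p)
        (\<lambda>\<omega>. indicator B (observation \<omega>) * indicator (edges (fst \<omega>)) e)
      = measure_pmf.expectation (planted_model n G p)
        (\<lambda>\<omega>. indicator B (observation \<omega>) * posterior e (observation \<omega>))"
    using expectation_observed[of "\<lambda>S Y. indicator B Y * indicator (edges S) e"]
      expectation_observed[of "\<lambda>S Y. indicator B Y * posterior e Y"]
    by (simp only: sum_eq)
  then show "(\<integral>\<omega>\<in>A. planted_edge e \<omega> \<partial>measure_pmf (planted_model n G p))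
      = (\<integral>\<omega>\<in>A. posterior e (observation \<omega>) \<partial>measure_pmf (planted_model n G p))"
    by (simp add: set_lebesgue_integral_def A planted_edge_def indicator_vimage[symmetric] comp_def
        indicator_def of_bool_def)
qed (simp_all add: integrable_planted borel_measurable_obs)

definition mean_overlap :: "nat graph \<Rightarrow> nat set set \<Rightarrow> real" where
  "mean_overlap S Y = (\<Sum>T\<in>copies_in Y. real (card (edges S \<inter> edges T))) / card (copies_in Y)"

lemma sum_posterior:
  assumes S: "S \<in> C"
  shows "(\<Sum>e\<in>E. indicator (edges S) e * posterior e Y) = mean_overlap S Y"
proof -
  have "(\<Sum>e\<in>E. indicator (edges S) e * posterior e Y)
      = (\<Sum>e\<in>E. \<Sum>T\<in>copies_in Y. indicator (edges S \<inter> edges T) e) / card (copies_in Y)"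
    by (simp add: posterior_def sum_divide_distrib sum_distrib_left indicator_inter_arith)
  also have "(\<Sum>e\<in>E. \<Sum>T\<in>copies_in Y. indicator (edges S \<inter> edges T) e)
      = (\<Sum>T\<in>copies_in Y. \<Sum>e\<in>E. indicator (edges S \<inter> edges T) e :: real)"
    by (rule sum.swap)
  also have "\<dots> = (\<Sum>T\<in>copies_in Y. real (card (edges S \<inter> edges T)))"
  proof (rule sum.cong)
    fix T
    have "E \<inter> (edges S \<inter> edges T) = edges S \<inter> edges T" using copy(3)[OF S] by auto
    then show "(\<Sum>e\<in>E. indicator (edges S \<inter> edges T) e) = real (card (edges S \<inter> edges T))"
      using finite_edges_complete_graph by (simp add: sum_indicator_real)
  qed simp
  finally show ?thesis by (simp add: mean_overlap_def)
qed

text \<open>By the tower property the squared error of a coordinate is the expectation of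
\<open>X - X * posterior\<close>, where \<open>X\<close> is the indicator of a planted edge. Summing over the edges turns the
first term into \<open>k\<close> and the second into the average overlap.\<close>

lemma MMSE_eq:
  "MMSE n G p = k - measure_pmf.expectation (planted_model n G p)
     (\<lambda>\<omega>. mean_overlap (fst \<omega>) (observation \<omega>))"
proof -
  let ?P = "planted_model n G p" and ?E = "measure_pmf.expectation (planted_model n G p)"
  let ?X = planted_edge and ?m = "posterior_mean n G p"
  note int = integrable_planted
  have tower: "?E (\<lambda>\<omega>. ?m e \<omega> * ?m e \<omega>) = ?E (\<lambda>\<omega>. ?m e \<omega> * ?X e \<omega>)" for e
    unfolding posterior_mean_def
    by (rule sigma_finite_subalgebra.real_cond_exp_intg(2)
        [OF finite_measure_subalgebra_is_sigma_finite[OF finite_measure_subalgebra_obs]])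
      (auto simp: int)
  have coord: "?E (\<lambda>\<omega>. (?X e \<omega> - ?m e \<omega>)\<^sup>2)
      = ?E (\<lambda>\<omega>. ?X e \<omega> - ?X e \<omega> * posterior e (observation \<omega>))" for e
  proof -
    have "?E (\<lambda>\<omega>. (?X e \<omega> - ?m e \<omega>)\<^sup>2)
        = ?E (\<lambda>\<omega>. (?X e \<omega> - 2 * (?m e \<omega> * ?X e \<omega>)) + ?m e \<omega> * ?m e \<omega>)"
      by (rule arg_cong[of _ _ ?E])
        (auto simp: fun_eq_iff planted_edge_def indicator_def power2_eq_square algebra_simps)
    also have "\<dots> = (?E (\<lambda>\<omega>. ?X e \<omega>) - 2 * ?E (\<lambda>\<omega>. ?m e \<omega> * ?X e \<omega>)) + ?E (\<lambda>\<omega>. ?m e \<omega> * ?m e \<omega>)"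
      by (simp add: int)
    also have "\<dots> = ?E (\<lambda>\<omega>. ?X e \<omega> - ?m e \<omega> * ?X e \<omega>)"
      by (simp add: tower int)
    also have "\<dots> = ?E (\<lambda>\<omega>. ?X e \<omega> - ?X e \<omega> * posterior e (observation \<omega>))"
      using posterior_mean_eq[of e]
      by (intro expectation_cong_planted) (auto simp: AE_measure_pmf_iff)
    finally show ?thesis .
  qed
  have "MMSE n G p = (\<Sum>e\<in>E. ?E (\<lambda>\<omega>. (?X e \<omega> - ?m e \<omega>)\<^sup>2))"
    unfolding MMSE_def by (rule Bochner_Integration.integral_sum) (rule int)
  also have "\<dots> = (\<Sum>e\<in>E. ?E (\<lambda>\<omega>. ?X e \<omega> - ?X e \<omega> * posterior e (observation \<omega>)))"
    by (simp add: coord)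
  also have "\<dots> = ?E (\<lambda>\<omega>. \<Sum>e\<in>E. ?X e \<omega> - ?X e \<omega> * posterior e (observation \<omega>))"
    by (rule Bochner_Integration.integral_sum[symmetric]) (rule int)
  also have "\<dots> = ?E (\<lambda>\<omega>. real k - mean_overlap (fst \<omega>) (observation \<omega>))"
  proof (rule expectation_cong_planted)
    fix \<omega> assume "\<omega> \<in> set_pmf ?P"
    then have S: "fst \<omega> \<in> C" by (rule planted_support)
    have "(\<Sum>e\<in>E. indicator (edges (fst \<omega>)) e) = real k"
      using finite_edges_complete_graph copy(3,5)[OF S]
      by (simp add: sum_indicator_real Int_absorb1)
    then show "(\<Sum>e\<in>E. ?X e \<omega> - ?X e \<omega> * posterior e (observation \<omega>))
        = real k - mean_overlap (fst \<omega>) (observation \<omega>)"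
      by (simp add: sum_subtractf planted_edge_def sum_posterior[OF S])
  qed
  also have "\<dots> = real k - ?E (\<lambda>\<omega>. mean_overlap (fst \<omega>) (observation \<omega>))"
    by (simp add: int)
  finally show ?thesis .
qed

section \<open>Bounds on the error from the overlap counts\<close>

text \<open>Given the planted copy, another copy is observed if and only if the noise contains its edges off
the planted one. Grouping the copies by the number \<open>r\<close> of these edges, the factor \<open>p ^ r\<close> and the
bound on the number of copies combine to the \<open>r\<close>-th power of \<open>p / p_1M\<close>.\<close>

lemma expectation_sum_overlap_le:
  fixes \<phi> :: "nat \<Rightarrow> real"
  assumes ov: "overlap_bounded n G" and \<phi>: "\<And>j. 0 \<le> \<phi> j" and k: "0 < k"
  shows "measure_pmf.expectation (planted_model n G p)
      (\<lambda>\<omega>. \<Sum>T\<in>copies_in (observation \<omega>). \<phi> (card (edges (fst \<omega>) \<inter> edges T)))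
    \<le> (\<Sum>r\<le>k. \<phi> (k - r) * (p / p_1M n G) ^ r)"
    (is "?L \<le> ?R")
proof -
  have pM: "(p / p_1M n G) ^ r = num_copies n G powr (r / k) * p ^ r" for r
    using num_copies_pos
    by (simp add: p_1M_def powr_minus_divide power_mult_distrib powr_power mult.commute)
  have "measure_pmf.expectation (gnp n p)
      (\<lambda>X. \<Sum>T\<in>copies_in (edges S \<union> X). \<phi> (card (edges S \<inter> edges T))) \<le> ?R" if S: "S \<in> C" for S
  proof -
    let ?i = "\<lambda>T. card (edges S \<inter> edges T)"
    have i_le: "?i T \<le> k" for T
      using card_mono[OF copy(6)[OF S], of "edges S \<inter> edges T"] copy(5)[OF S] by simp
    have prob: "measure_pmf.prob (gnp n p) {X. edges T \<subseteq> edges S \<union> X} = p ^ (k - ?i T)"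
      if T: "T \<in> C" for T
    proof -
      have "{X. edges T \<subseteq> edges S \<union> X} = {X. edges T - edges S \<subseteq> X}" by auto
      moreover have "card (edges T - edges S) = k - ?i T"
        using copy(5,6)[OF T] by (simp add: card_Diff_subset_Int Int_commute)
      moreover have "edges T - edges S \<subseteq> E" using copy(3)[OF T] by auto
      ultimately show ?thesis using prob_gnp_superset[OF p01] by simp
    qed
    have "measure_pmf.expectation (gnp n p) (\<lambda>X. \<Sum>T\<in>copies_in (edges S \<union> X). \<phi> (?i T))
        = measure_pmf.expectation (gnp n p)
          (\<lambda>X. \<Sum>T\<in>C. \<phi> (?i T) * indicator {X. edges T \<subseteq> edges S \<union> X} X)"
      unfolding copies_in_def sum.inter_filter[OF finite_C]
      by (intro arg_cong[of _ _ "measure_pmf.expectation (gnp n p)"] ext sum.cong) auto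
    also have "\<dots> = (\<Sum>T\<in>C. measure_pmf.expectation (gnp n p)
          (\<lambda>X. \<phi> (?i T) * indicator {X. edges T \<subseteq> edges S \<union> X} X))"
      by (rule Bochner_Integration.integral_sum)
        (rule integrable_measure_pmf_finite[OF finite_set_pmf_gnp])
    also have "\<dots> = (\<Sum>T\<in>C. \<phi> (?i T) * p ^ (k - ?i T))"
      using prob by simp
    also have "\<dots> = (\<Sum>r\<le>k. \<Sum>T\<in>{T \<in> C. k - ?i T = r}. \<phi> (?i T) * p ^ (k - ?i T))"
      by (rule sum.group[symmetric]) (auto simp: finite_C)
    also have "\<dots> = (\<Sum>r\<le>k. card {T \<in> C. ?i T = k - r} * (\<phi> (k - r) * p ^ r))"
    proof (rule sum.cong)
      fix r assume r: "r \<in> {..k}"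
      have "{T \<in> C. k - ?i T = r} = {T \<in> C. ?i T = k - r}"
        using i_le r by (auto intro: diff_diff_cancel[symmetric])
      then show "(\<Sum>T\<in>{T \<in> C. k - ?i T = r}. \<phi> (?i T) * p ^ (k - ?i T))
          = card {T \<in> C. ?i T = k - r} * (\<phi> (k - r) * p ^ r)"
        using r by simp
    qed simp
    also have "\<dots> \<le> (\<Sum>r\<le>k. num_copies n G powr (r / k) * (\<phi> (k - r) * p ^ r))"
      using ov S \<phi> p01 unfolding overlap_bounded_def
      by (intro sum_mono mult_right_mono) auto
    also have "\<dots> = ?R" by (simp add: pM mult_ac)
    finally show ?thesis .
  qed
  then have "?L \<le> (\<Sum>S\<in>C. ?R) / card C"
    unfolding expectation_planted observation_def
    by (intro divide_right_mono sum_mono) auto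
  also have "\<dots> = ?R" using C_nonempty finite_C by simp
  finally show ?thesis .
qed

lemma mean_overlap_bounds:
  assumes "S \<in> C"
  shows "0 \<le> mean_overlap S Y" "mean_overlap S Y \<le> k"
proof -
  show "0 \<le> mean_overlap S Y" by (simp add: mean_overlap_def sum_nonneg)
  have "card (edges S \<inter> edges T) \<le> k" for T
    using card_mono[OF copy(6)[OF assms], of "edges S \<inter> edges T"] copy(5)[OF assms] by simp
  then have "(\<Sum>T\<in>copies_in Y. real (card (edges S \<inter> edges T))) \<le> card (copies_in Y) * real k"
    by (intro sum_bounded_above) simp
  then show "mean_overlap S Y \<le> k"
    by (cases "card (copies_in Y) = 0") (auto simp: mean_overlap_def divide_simps mult.commute)
qed

lemma MMSE_bounds: "0 \<le> MMSE n G p" "MMSE n G p \<le> k"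
proof -
  show "0 \<le> MMSE n G p"
    unfolding MMSE_def by (intro Bochner_Integration.integral_nonneg sum_nonneg) auto
  have "measure_pmf.expectation (planted_model n G p) (\<lambda>_. 0)
      \<le> measure_pmf.expectation (planted_model n G p)
          (\<lambda>\<omega>. mean_overlap (fst \<omega>) (observation \<omega>))"
    by (rule expectation_mono_planted) (auto intro: mean_overlap_bounds planted_support)
  then show "MMSE n G p \<le> k" by (simp add: MMSE_eq)
qed

text \<open>The planted copy itself is always observed, so the posterior average of the number of missed edges
has denominator at least 1 and is at most the sum over all observed copies.\<close>

lemma MMSE_upper:
  assumes ov: "overlap_bounded n G" and k: "0 < k"
  shows "MMSE n G p \<le> (\<Sum>r\<le>k. r * (p / p_1M n G) ^ r)"
proof -
  have "MMSE n G p = measure_pmf.expectation (planted_model n G p)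
      (\<lambda>\<omega>. k - mean_overlap (fst \<omega>) (observation \<omega>))"
    by (simp add: MMSE_eq integrable_planted)
  also have "\<dots> \<le> measure_pmf.expectation (planted_model n G p)
      (\<lambda>\<omega>. \<Sum>T\<in>copies_in (observation \<omega>). real (k - card (edges (fst \<omega>) \<inter> edges T)))"
  proof (rule expectation_mono_planted)
    fix \<omega> assume \<omega>: "\<omega> \<in> set_pmf (planted_model n G p)"
    let ?S = "fst \<omega>" and ?Z = "copies_in (observation \<omega>)"
    let ?i = "\<lambda>T. card (edges ?S \<inter> edges T)"
    have S: "?S \<in> C" and "?S \<in> ?Z" using planted_support[OF \<omega>] by auto
    then have Z: "0 < card ?Z" using finite_copies_in by (auto simp: card_gt_0_iff)
    have i_le: "?i T \<le> k" for T
      using card_mono[OF copy(6)[OF S], of "edges ?S \<inter> edges T"] copy(5)[OF S] by simp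
    have "k - mean_overlap ?S (observation \<omega>) = (\<Sum>T\<in>?Z. real (k - ?i T)) / card ?Z"
      using Z i_le by (simp add: mean_overlap_def of_nat_diff sum_subtractf field_simps)
    also have "\<dots> \<le> (\<Sum>T\<in>?Z. real (k - ?i T)) / 1"
      using Z by (intro divide_left_mono sum_nonneg) auto
    finally show "k - mean_overlap ?S (observation \<omega>) \<le> (\<Sum>T\<in>?Z. real (k - ?i T))" by simp
  qed
  also have "\<dots> \<le> (\<Sum>r\<le>k. real (k - (k - r)) * (p / p_1M n G) ^ r)"
    by (rule expectation_sum_overlap_le[OF ov _ k]) simp
  also have "\<dots> = (\<Sum>r\<le>k. r * (p / p_1M n G) ^ r)"
    by (intro sum.cong) auto
  finally show ?thesis .
qed

text \<open>Up to the factor \<open>p ^ k\<close>, the weight of \<open>Y\<close> is its probability under the random graph without a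
planted copy. The restriction to \<open>Y\<close> that contain a copy guarantees \<open>k \<le> card Y\<close>, without which the
truncated subtraction in the weight would break this relation.\<close>

lemma sum_weight_le:
  assumes "0 < p"
  shows "(\<Sum>Y\<in>{Y \<in> Pow E. copies_in Y \<noteq> {}}. weight Y) \<le> 1 / p ^ k"
proof -
  have finP: "finite (Pow E)" using finite_edges_complete_graph by simp
  have "(\<Sum>Y\<in>{Y \<in> Pow E. copies_in Y \<noteq> {}}. weight Y)
      = (\<Sum>Y\<in>{Y \<in> Pow E. copies_in Y \<noteq> {}}. p ^ card Y * (1 - p) ^ (card E - card Y)) / p ^ k"
    unfolding sum_divide_distrib
  proof (rule sum.cong)
    fix Y assume "Y \<in> {Y \<in> Pow E. copies_in Y \<noteq> {}}"
    then obtain S where S: "S \<in> C" "edges S \<subseteq> Y" and Y: "Y \<subseteq> E" by (auto simp: copies_in_def)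
    have "k \<le> card Y"
      using card_mono[OF finite_subset[OF Y finite_edges_complete_graph] S(2)] copy(5)[OF S(1)]
      by simp
    then show "weight Y = p ^ card Y * (1 - p) ^ (card E - card Y) / p ^ k"
      using assms by (simp add: weight_def power_diff)
  qed simp
  also have "\<dots> \<le> (\<Sum>Y\<in>Pow E. p ^ card Y * (1 - p) ^ (card E - card Y)) / p ^ k"
    using p01 finP by (intro divide_right_mono sum_mono2) auto
  also have "(\<Sum>Y\<in>Pow E. p ^ card Y * (1 - p) ^ (card E - card Y)) = (\<Prod>e\<in>E. p + (1 - p))"
    unfolding prod_add[OF finite_edges_complete_graph]
    using finite_edges_complete_graph
    by (intro sum.cong) (auto simp: card_Diff_subset finite_subset)
  finally show ?thesis by simp
qed

text \<open>The density of the planted law with respect to \<open>G(n,p)\<close> is the number of copies divided by its mean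
\<open>M p ^ k\<close>. Hence observations with at most \<open>t\<close> copies, where the density is at most
\<open>t / (M p ^ k)\<close>, have at most that probability.\<close>

lemma prob_few_copies_le:
  fixes t :: real
  assumes "0 < p" "0 \<le> t"
  shows "measure_pmf.expectation (planted_model n G p)
      (\<lambda>\<omega>. of_bool (real (card (copies_in (observation \<omega>))) \<le> t)) \<le> t / (num_copies n G * p ^ k)"
proof -
  have finP: "finite (Pow E)" using finite_edges_complete_graph by simp
  have w: "0 \<le> weight Y" for Y using p01 by (simp add: weight_def)
  have "(\<Sum>Y\<in>Pow E. weight Y * (\<Sum>S\<in>copies_in Y. of_bool (real (card (copies_in Y)) \<le> t)))
      \<le> (\<Sum>Y\<in>Pow E. if copies_in Y \<noteq> {} then weight Y * t else 0)"
    using w assms by (intro sum_mono) (auto intro!: mult_left_mono)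
  also have "\<dots> = (\<Sum>Y\<in>{Y \<in> Pow E. copies_in Y \<noteq> {}}. weight Y * t)"
    by (rule sum.inter_filter[OF finP, symmetric])
  also have "\<dots> = (\<Sum>Y\<in>{Y \<in> Pow E. copies_in Y \<noteq> {}}. weight Y) * t"
    by (rule sum_distrib_right[symmetric])
  also have "\<dots> \<le> 1 / p ^ k * t"
    by (rule mult_right_mono[OF sum_weight_le[OF assms(1)] assms(2)])
  finally have "(\<Sum>Y\<in>Pow E. weight Y * (\<Sum>S\<in>copies_in Y. of_bool (real (card (copies_in Y)) \<le> t))) / card C
      \<le> 1 / p ^ k * t / card C"
    by (rule divide_right_mono) simp
  then show ?thesis
    unfolding expectation_observed[of "\<lambda>S Y. of_bool (real (card (copies_in Y)) \<le> t)"]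
    by (simp add: card_C mult.commute)
qed

text \<open>Apart from an event of probability at most \<open>\<eta>\<close>, the observation contains more than \<open>\<eta> M p ^ k\<close>
copies, so the average overlap is at most the total overlap divided by this number. By the overlap
bound the total overlap divided by \<open>M p ^ k = (p / p_1M) ^ k\<close> is at most
\<open>\<Sum>r. r (p_1M / p) ^ r\<close> in expectation, where \<open>r\<close> is the size of the overlap.\<close>

lemma MMSE_lower:
  fixes \<eta> :: real
  assumes ov: "overlap_bounded n G" and k: "0 < k" and p: "0 < p" and \<eta>: "0 < \<eta>"
  shows "k - MMSE n G p \<le> k * \<eta> + (\<Sum>r\<le>k. r * (p_1M n G / p) ^ r) / \<eta>"
proof -
  let ?M = "num_copies n G" and ?a = "p / p_1M n G"
  define t where "t = \<eta> * (?M * p ^ k)"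
  have M: "0 < ?M" by (rule num_copies_pos)
  then have t: "0 < t" using p \<eta> by (simp add: t_def)
  have a: "0 < ?a" using p M by (simp add: p_1M_def)
  have ak: "?a ^ k = ?M * p ^ k"
    using M k
    by (simp add: p_1M_def powr_minus_divide power_mult_distrib powr_power mult.commute)
  have "k - MMSE n G p = measure_pmf.expectation (planted_model n G p)
      (\<lambda>\<omega>. mean_overlap (fst \<omega>) (observation \<omega>))"
    by (simp add: MMSE_eq)
  also have "\<dots> \<le> measure_pmf.expectation (planted_model n G p)
      (\<lambda>\<omega>. k * of_bool (real (card (copies_in (observation \<omega>))) \<le> t)
        + (\<Sum>T\<in>copies_in (observation \<omega>). real (card (edges (fst \<omega>) \<inter> edges T))) / t)"
  proof (rule expectation_mono_planted)
    fix \<omega> assume \<omega>: "\<omega> \<in> set_pmf (planted_model n G p)"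
    let ?s = "\<Sum>T\<in>copies_in (observation \<omega>). real (card (edges (fst \<omega>) \<inter> edges T))"
    have s: "0 \<le> ?s" by (simp add: sum_nonneg)
    show "mean_overlap (fst \<omega>) (observation \<omega>)
      \<le> k * of_bool (real (card (copies_in (observation \<omega>))) \<le> t) + ?s / t"
    proof (cases "real (card (copies_in (observation \<omega>))) \<le> t")
      case True
      moreover have "0 \<le> ?s / t" using s t by simp
      ultimately show ?thesis
        using mean_overlap_bounds(2)[OF planted_support(1)[OF \<omega>], of "observation \<omega>"] by simp
    next
      case False
      have "?s / card (copies_in (observation \<omega>)) \<le> ?s / t"
        using False t s by (intro divide_left_mono mult_pos_pos) auto
      then show ?thesis using False by (simp add: mean_overlap_def)
    qed
  qed
  also have "\<dots> = k * measure_pmf.expectation (planted_model n G p)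
        (\<lambda>\<omega>. of_bool (real (card (copies_in (observation \<omega>))) \<le> t))
      + measure_pmf.expectation (planted_model n G p)
        (\<lambda>\<omega>. \<Sum>T\<in>copies_in (observation \<omega>). real (card (edges (fst \<omega>) \<inter> edges T))) / t"
    by (simp add: integrable_planted)
  also have "\<dots> \<le> k * (t / (?M * p ^ k)) + (\<Sum>r\<le>k. real (k - r) * ?a ^ r) / t"
    using t prob_few_copies_le[OF p, of t] expectation_sum_overlap_le[OF ov _ k, of real]
    by (intro add_mono mult_left_mono divide_right_mono) auto
  also have "t / (?M * p ^ k) = \<eta>" using M p by (simp add: t_def)
  also have "(\<Sum>r\<le>k. real (k - r) * ?a ^ r) / t = (\<Sum>r\<le>k. real (k - r) * (1 / ?a) ^ (k - r)) / \<eta>"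
  proof -
    have "real (k - r) * ?a ^ r / t = real (k - r) * (1 / ?a) ^ (k - r) / \<eta>" if "r \<le> k" for r
    proof -
      have "?a ^ k = ?a ^ r * ?a ^ (k - r)" using that by (simp flip: power_add)
      then have "t = \<eta> * (?a ^ r * ?a ^ (k - r))" by (simp only: t_def ak)
      moreover have "j * x / (\<eta> * (x * y)) = j * (1 / y) / \<eta>" if "0 < x" for j x y :: real
        using that by simp
      ultimately show ?thesis using a by (simp only: power_one_over zero_less_power)
    qed
    then show ?thesis by (simp add: sum_divide_distrib)
  qed
  also have "(\<Sum>r\<le>k. real (k - r) * (1 / ?a) ^ (k - r)) = (\<Sum>r\<le>k. r * (1 / ?a) ^ r)"
    by (rule sum.reindex_bij_witness[of _ "\<lambda>r. k - r" "\<lambda>r. k - r"]) auto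
  finally show ?thesis by simp
qed

end

section \<open>The transition\<close>

text \<open>The derivative of the geometric series makes the bound uniform in \<open>k\<close>.\<close>

lemma sum_times_power_le:
  fixes q x :: real
  assumes "0 \<le> x" "x \<le> q" "q < 1"
  shows "(\<Sum>r\<le>k. real r * x ^ r) \<le> 1 / (1 - q)\<^sup>2"
proof -
  have q: "(\<lambda>r. of_nat (Suc r) * q ^ r) sums (1 / (1 - q)\<^sup>2)"
    using assms by (intro geometric_deriv_sums) auto
  have "(\<Sum>r\<le>k. real r * x ^ r) \<le> (\<Sum>r\<le>k. of_nat (Suc r) * q ^ r)"
    using assms by (intro sum_mono mult_mono power_mono) auto
  also have "\<dots> \<le> (\<Sum>r. of_nat (Suc r) * q ^ r)"
    using assms by (intro sum_le_suminf sums_summable[OF q]) auto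
  also have "\<dots> = 1 / (1 - q)\<^sup>2" using sums_unique[OF q] by simp
  finally show ?thesis .
qed

lemma p_1M_bounds:
  assumes "simple_graph G" "card (verts G) \<le> n"
  shows "0 < p_1M n G" "p_1M n G \<le> 1"
proof -
  have "0 < n choose card (verts G)" using assms by simp
  then have "1 \<le> real (n choose card (verts G))" by linarith
  then have M: "1 \<le> num_copies n G" using num_copies_ge_binomial[OF assms] by linarith
  then show "0 < p_1M n G" by (simp add: p_1M_def)
  have "num_copies n G powr (- 1 / real (card (edges G))) \<le> num_copies n G powr 0"
    using M by (intro powr_mono) (auto simp: divide_nonpos_nonneg)
  then show "p_1M n G \<le> 1" using M by (simp add: p_1M_def)
qed

text \<open>Eventually the overlap bound holds, and the two non-asymptotic estimates apply. For the lower bound,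
the choice \<open>\<eta> = 1 / sqrt k\<close> balances the terms \<open>k \<eta>\<close> and \<open>B / \<eta>\<close>, and both are of smaller order
than \<open>k\<close>.\<close>

theorem theorem4p9:
  fixes H :: "nat \<Rightarrow> 'a graph" and c :: real
  assumes "c > 0"
    and "\<And>n. simple_graph (H n)"
    and "\<And>n. card (verts (H n)) \<le> n"
    and "\<And>n. strongly_balanced c (H n)"
    and "filterlim (\<lambda>n. card (verts (H n))) at_top sequentially"
    and "filterlim (\<lambda>n. card (edges (H n))) at_top sequentially"
    and "\<forall>\<^sub>F n in sequentially.
           real (card (verts (H n)) + card (edges (H n))) \<le> c * ln (real n) / (3 * ln (ln (real n)))"
  shows "exhibits_AoN H (\<lambda>n. p_1M n (H n))"
proof -
  let ?k = "\<lambda>n. card (edges (H n))"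
  note p1 = p_1M_bounds[OF assms(2,3)]
  have pos: "\<forall>\<^sub>F n in sequentially. 0 < card (verts (H n))" "\<forall>\<^sub>F n in sequentially. 0 < ?k n"
    by (rule eventually_compose_filterlim[OF eventually_gt_at_top assms(5)])
      (rule eventually_compose_filterlim[OF eventually_gt_at_top assms(6)])
  have ov: "\<forall>\<^sub>F n in sequentially. overlap_bounded n (H n)"
    using eventually_sparse[OF assms(1) pos assms(7)] pos
    by eventually_elim (rule overlap_bounded_if_sparse[OF assms(2,3,4)])
  have k_real: "filterlim (\<lambda>n. real (?k n)) at_top sequentially"
    by (rule filterlim_compose[OF filterlim_real_sequentially assms(6)])
  have above: "(\<lambda>n. MMSE n (H n) (p n) / real (?k n)) \<longlonglongrightarrow> 1"
    if \<epsilon>: "\<epsilon> > 0" and p: "\<And>n. p n \<in> {0..1}"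
      and large: "\<forall>\<^sub>F n in sequentially. p n \<ge> (1 + \<epsilon>) * p_1M n (H n)" for \<epsilon> :: real and p
  proof (rule tendsto_sandwich)
    define q where "q = 1 / (1 + \<epsilon>)"
    define B where "B = 1 / (1 - q)\<^sup>2"
    have q: "q < 1" using \<epsilon> by (simp add: q_def)
    show "\<forall>\<^sub>F n in sequentially. 1 - (1 + B) / sqrt (?k n) \<le> MMSE n (H n) (p n) / real (?k n)"
      using ov pos(2) large
    proof eventually_elim
      case (elim n)
      interpret planted n "H n" "p n"
        using assms(2,3) p by unfold_locales
      have pn: "0 < p n"
        using elim(3) p1(1)[of n] \<epsilon> by (smt (verit) mult_pos_pos)
      have x: "0 \<le> p_1M n (H n) / p n" "p_1M n (H n) / p n \<le> q"
        using elim(3) p1(1)[of n] pn \<epsilon> by (auto simp: q_def field_simps)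
      have s: "0 < 1 / sqrt (?k n)" using elim by simp
      have "?k n - MMSE n (H n) (p n) \<le> ?k n * (1 / sqrt (?k n))
          + (\<Sum>r\<le>?k n. r * (p_1M n (H n) / p n) ^ r) / (1 / sqrt (?k n))"
        by (rule MMSE_lower[OF elim(1,2) pn s])
      also have "\<dots> \<le> ?k n * (1 / sqrt (?k n)) + B / (1 / sqrt (?k n))"
        unfolding B_def using sum_times_power_le[OF x q] s
        by (intro add_left_mono divide_right_mono) auto
      also have "\<dots> = (1 + B) * sqrt (?k n)"
        using elim by (simp add: real_div_sqrt algebra_simps)
      finally have "1 - MMSE n (H n) (p n) / ?k n \<le> (1 + B) * sqrt (?k n) / ?k n"
        using elim by (simp add: divide_simps)
      also have "\<dots> = (1 + B) / sqrt (?k n)"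
        using elim by (simp add: divide_simps)
      finally show ?case by simp
    qed
    show "\<forall>\<^sub>F n in sequentially. MMSE n (H n) (p n) / real (?k n) \<le> 1"
    proof (intro always_eventually allI)
      fix n
      interpret planted n "H n" "p n"
        using assms(2,3) p by unfold_locales
      show "MMSE n (H n) (p n) / real (?k n) \<le> 1"
        using MMSE_bounds(2) by (cases "?k n = 0") (auto simp: divide_le_eq_1)
    qed
    have "(\<lambda>n. (1 + B) / sqrt (?k n)) \<longlonglongrightarrow> 0"
      by (intro real_tendsto_divide_at_top[OF tendsto_const]
          filterlim_compose[OF sqrt_at_top k_real])
    from tendsto_diff[OF tendsto_const[of 1] this]
    show "(\<lambda>n. 1 - (1 + B) / sqrt (?k n)) \<longlonglongrightarrow> 1" by simp
  qed auto
  have below: "(\<lambda>n. MMSE n (H n) (p n) / real (?k n)) \<longlonglongrightarrow> 0"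
    if \<epsilon>: "\<epsilon> > 0" and p: "\<And>n. p n \<in> {0..1}"
      and small: "\<forall>\<^sub>F n in sequentially. p n \<le> (1 - \<epsilon>) * p_1M n (H n)" for \<epsilon> :: real and p
  proof (rule tendsto_sandwich)
    \<comment> \<open>The maximum keeps \<open>q\<close> in the range of the power sum bound also for \<open>\<epsilon> > 1\<close>, where no density meets the hypothesis.\<close>
    define q where "q = max 0 (1 - \<epsilon>)"
    define B where "B = 1 / (1 - q)\<^sup>2"
    have q: "q < 1" using \<epsilon> by (simp add: q_def)
    show "\<forall>\<^sub>F n in sequentially. 0 \<le> MMSE n (H n) (p n) / real (?k n)"
    proof (intro always_eventually allI)
      fix n
      interpret planted n "H n" "p n"
        using assms(2,3) p by unfold_locales
      show "0 \<le> MMSE n (H n) (p n) / real (?k n)"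
        using MMSE_bounds(1) by simp
    qed
    show "\<forall>\<^sub>F n in sequentially. MMSE n (H n) (p n) / real (?k n) \<le> B / real (?k n)"
      using ov pos(2) small
    proof eventually_elim
      case (elim n)
      interpret planted n "H n" "p n"
        using assms(2,3) p by unfold_locales
      have "p n / p_1M n (H n) \<le> 1 - \<epsilon>"
        using elim(3) p1(1)[of n] by (simp add: pos_divide_le_eq)
      then have x: "0 \<le> p n / p_1M n (H n)" "p n / p_1M n (H n) \<le> q"
        using p1(1)[of n] p01 by (auto simp: q_def)
      have "MMSE n (H n) (p n) \<le> B"
        using MMSE_upper[OF elim(1,2)] sum_times_power_le[OF x q, of "?k n"] by (simp add: B_def)
      then show ?case by (rule divide_right_mono) simp
    qed
    show "(\<lambda>n. B / real (?k n)) \<longlonglongrightarrow> 0"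
      by (rule real_tendsto_divide_at_top[OF tendsto_const k_real])
  qed auto
  show ?thesis
    unfolding exhibits_AoN_def
  proof (intro conjI allI impI)
    fix n show "p_1M n (H n) \<in> {0..1}" using p1[of n] by simp
  next
    fix \<epsilon> :: real and p :: "nat \<Rightarrow> real" assume "\<epsilon> > 0"
    {
      assume "(\<forall>n. p n \<in> {0..1}) \<and> (\<forall>\<^sub>F n in sequentially. p n \<ge> (1 + \<epsilon>) * p_1M n (H n))"
      then show "(\<lambda>n. MMSE n (H n) (p n) / real (?k n)) \<longlonglongrightarrow> 1"
        using \<open>\<epsilon> > 0\<close> by (intro above) auto
    next
      assume "(\<forall>n. p n \<in> {0..1}) \<and> (\<forall>\<^sub>F n in sequentially. p n \<le> (1 - \<epsilon>) * p_1M n (H n))"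
      then show "(\<lambda>n. MMSE n (H n) (p n) / real (?k n)) \<longlonglongrightarrow> 0"
        using \<open>\<epsilon> > 0\<close> by (intro below) auto
    }
  qed
qed

end
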